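(* For the class $\mathcal{S}_{\mathrm{lune}}^*$ of starlike functions associated with a lune, the following hold: (i) $R_{\mathcal{S}_{\mathrm{lune}}^{*}}(\mathcal{G}_1)= \dfrac{6-4\sqrt{2}}{(2-\sqrt{2})\left(3+\sqrt{15-4\sqrt{2}}\right)}\approx 0.0967$; (ii) $R_{\mathcal{S}_{\mathrm{lune}}^{*}}(\mathcal{G}_2)\geq \dfrac{16-10\sqrt{2}}{(3-\sqrt{2})\left(5+\sqrt{57-20\sqrt{2}}\right)}\approx 0.1131$; (iii) $R_{\mathcal{S}_{\mathrm{lune}}^{*}}(\mathcal{G}_3)= \dfrac{6-4\sqrt{2}}{(2-\sqrt{2})\left(2+\sqrt{10-4\sqrt{2}}\right)}\approx 0.1434$.
   Context: $\mathbb{D}$ is the open unit disc in $\mathbb{C}$. $\mathcal{A}$ is the class of analytic functions $f$ on $\mathbb{D}$ with $f(0)=0$, $f'(0)=1$. $\mathcal{P}$ is the class of analytic functions $p$ on $\mathbb{D}$ with $p(0)=1$ and $\operatorname{Re}p(z)>0$ for all $z\in\mathbb{D}$; $\mathcal{P}(1/2)=\{p\in\mathcal{P}:\operatorname{Re}p(z)>1/2 \text{ for all } z\in\mathbb{D}\}$. Quotients below are understood with removable singularities filled in (in particular at $0$). Define $\mathcal{G}_1=\{f\in\mathcal{A}: f/g\in\mathcal{P}\text{ and } g/(zp)\in\mathcal{P}\text{ for some } g\in\mathcal{A},\ p\in\mathcal{P}\}$, $\mathcal{G}_2=\{f\in\mathcal{A}: f/g\in\mathcal{P}\text{ and } g/(zp)\in\mathcal{P}(1/2)\text{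 for some } g\in\mathcal{A},\ p\in\mathcal{P}\}$, $\mathcal{G}_3=\{f\in\mathcal{A}: f/(zp)\in\mathcal{P}\text{ for some } p\in\mathcal{P}\}$. For subclasses $\mathcal{F},\mathcal{G}$ of $\mathcal{A}$, the $\mathcal{G}$-radius $R_{\mathcal{G}}(\mathcal{F})$ of $\mathcal{F}$ is the largest number $R\in(0,1)$ such that, for every $f\in\mathcal{F}$ and every $0<r<R$, the function $z\mapsto r^{-1}f(rz)$ belongs to $\mathcal{G}$. For analytic $f,g$ on $\mathbb{D}$, $f\prec g$ ($f$ is subordinate to $g$) means $f=g\circ w$ for some analytic $w:\mathbb{D}\to\mathbb{D}$ with $w(0)=0$. For an analytic univalent $\varphi$ on $\mathbb{D}$ with $\varphi(0)=1$, $\mathcal{S}^*(\varphi)=\{f\in\mathcal{A}: zf'(z)/f(z)\prec\varphi(z)\}$. $\mathcal{S}_{\mathrm{lune}}^*=\mathcal{S}^*\left(z+\sqrt{1+z^2}\right)$ (principal branch); equivalently, $f\in\mathcal{A}$ belongs to it iff $|(zf'(z)/f(z))^2-1|<2|zf'(z)/f(z)|$ on $\mathbb{D}$. *)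

theory Defs
  imports "HOL-Complex_Analysis.Complex_Analysis"
begin

text \<open>
  Functions on the open unit disc are total functions of type complex to complex; their values
  outside the disc are irrelevant. Quotients with removable singularities filled in are
  \<^const>\<open>remove_sings\<close> of the pointwise quotient. Where a singularity is not removable,
  \<^const>\<open>remove_sings\<close> does not produce a function holomorphic there, so that membership
  in the classes below fails as it should.
\<close>

abbreviation unit_disc :: "complex set" ("\<D>")
  where "\<D> \<equiv> ball 0 1"

definition class_A :: "(complex \<Rightarrow> complex) set"
  where "class_A = {f. f holomorphic_on \<D> \<and> f 0 = 0 \<and> deriv f 0 = 1}"

definition class_P :: "(complex \<Rightarrow> complex) set"
  where "class_P = {p. p holomorphic_on \<D> \<and> p 0 = 1 \<and> (\<forall>z\<in>\<D>. Re (p z) > 0)}"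

definition class_P_half :: "(complex \<Rightarrow> complex) set"
  where "class_P_half = {p \<in> class_P. \<forall>z\<in>\<D>. Re (p z) > 1 / 2}"

definition class_G1 :: "(complex \<Rightarrow> complex) set"
  where "class_G1 = {f \<in> class_A. \<exists>g\<in>class_A. \<exists>p\<in>class_P.
           remove_sings (\<lambda>z. f z / g z) \<in> class_P \<and>
           remove_sings (\<lambda>z. g z / (z * p z)) \<in> class_P}"

definition class_G2 :: "(complex \<Rightarrow> complex) set"
  where "class_G2 = {f \<in> class_A. \<exists>g\<in>class_A. \<exists>p\<in>class_P.
           remove_sings (\<lambda>z. f z / g z) \<in> class_P \<and>
           remove_sings (\<lambda>z. g z / (z * p z)) \<in> class_P_half}"

definition class_G3 :: "(complex \<Rightarrow> complex) set"
  where "class_G3 = {f \<in> class_A. \<exists>p\<in>class_P. remove_sings (\<lambda>z. f z / (z * p z)) \<in> class_P}"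

definition subordinate :: "(complex \<Rightarrow> complex) \<Rightarrow> (complex \<Rightarrow> complex) \<Rightarrow> bool" (infix "\<prec>\<^sub>s" 50)
  where "f \<prec>\<^sub>s g \<longleftrightarrow> f holomorphic_on \<D> \<and> g holomorphic_on \<D> \<and>
           (\<exists>w. w holomorphic_on \<D> \<and> w ` \<D> \<subseteq> \<D> \<and> w 0 = 0 \<and> (\<forall>z\<in>\<D>. f z = g (w z)))"

text \<open>Intended for \<open>\<phi>\<close> holomorphic and univalent on the disc with \<open>\<phi> 0 = 1\<close>.\<close>

definition starlike_class :: "(complex \<Rightarrow> complex) \<Rightarrow> (complex \<Rightarrow> complex) set" ("\<S>\<^sup>*")
  where "\<S>\<^sup>* \<phi> = {f \<in> class_A. remove_sings (\<lambda>z. z * deriv f z / f z) \<prec>\<^sub>s \<phi>}"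

definition lune_fun :: "complex \<Rightarrow> complex"
  where "lune_fun z = z + csqrt (1 + z\<^sup>2)"

definition class_S_lune :: "(complex \<Rightarrow> complex) set"
  where "class_S_lune = \<S>\<^sup>* lune_fun"

lemma lune_fun_admissible:
  "lune_fun holomorphic_on \<D>" "inj_on lune_fun \<D>" "lune_fun 0 = 1"
proof -
  have "1 + z\<^sup>2 \<notin> \<real>\<^sub>\<le>\<^sub>0" if "z \<in> \<D>" for z :: complex
  proof -
    have "cmod (z\<^sup>2) < 1"
      using that by (simp add: norm_power power_less_one_iff)
    then have "Re (1 + z\<^sup>2) > 0"
      using abs_Re_le_cmod[of "z\<^sup>2"] unfolding plus_complex.sel one_complex.sel by linarith
    then show ?thesis
      by (auto simp: complex_nonpos_Reals_iff simp del: plus_complex.sel)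
  qed
  then show "lune_fun holomorphic_on \<D>"
    unfolding lune_fun_def by (auto intro!: holomorphic_intros)
  have inv: "lune_fun z * (lune_fun z - 2 * z) = 1" for z
  proof -
    have "lune_fun z * (lune_fun z - 2 * z) = (csqrt (1 + z\<^sup>2))\<^sup>2 - z\<^sup>2"
      unfolding lune_fun_def by (simp add: algebra_simps power2_eq_square)
    then show ?thesis by simp
  qed
  show "inj_on lune_fun \<D>"
  proof (rule inj_onI)
    fix x y assume "lune_fun x = lune_fun y"
    then have "lune_fun x * (lune_fun x - 2 * x) = lune_fun x * (lune_fun x - 2 * y)"
      using inv[of x] inv[of y] by simp
    moreover have "lune_fun x \<noteq> 0"
      using inv[of x] by auto
    ultimately show "x = y" by simp
  qed
  show "lune_fun 0 = 1" by (simp add: lune_fun_def)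
qed

definition radius_admissible ::
    "(complex \<Rightarrow> complex) set \<Rightarrow> (complex \<Rightarrow> complex) set \<Rightarrow> real \<Rightarrow> bool"
  where "radius_admissible G F R \<longleftrightarrow> 0 < R \<and> R < 1 \<and>
           (\<forall>f\<in>F. \<forall>r. 0 < r \<and> r < R \<longrightarrow> (\<lambda>z. f (of_real r * z) / of_real r) \<in> G)"

text \<open>
  A relation rather than a function, so that stating it includes the existence of the largest
  admissible number.
\<close>

definition is_radius ::
    "(complex \<Rightarrow> complex) set \<Rightarrow> (complex \<Rightarrow> complex) set \<Rightarrow> real \<Rightarrow> bool"
  where "is_radius G F R \<longleftrightarrow>
           radius_admissible G F R \<and> (\<forall>R'. radius_admissible G F R' \<longrightarrow> R' \<le> R)"

end

theory Submission
  imports Defs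
begin

text \<open>
  A member of one of the three classes factors as \<open>f z = z * P z\<close>, where \<open>P\<close> is a product of two
  or three Caratheodory functions, one of which has real part above \<open>1/2\<close> in the case of
  \<^const>\<open>class_G2\<close>. Hence \<open>z f' / f - 1 = z P' / P\<close> is a sum of logarithmic derivatives, and these
  are controlled by the Schwarz-Pick inequality: with \<open>r = \<bar>z\<bar>\<close>, a factor contributes at most
  \<open>2 r / (1 - r\<^sup>2)\<close> (\<open>class_P_logderiv_bound\<close>), and a factor with real part above \<open>1/2\<close> at most
  \<open>r / (1 - r)\<close> (\<open>class_P_half_logderiv_bound\<close>).

  The lune contains the disc of radius \<open>2 - sqrt 2\<close> about 1. So scaling by factors up to \<open>R\<close> brings
  \<open>f\<close> into the lune class as long as the total bound stays below \<open>2 - sqrt 2\<close> for \<open>r < R\<close>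
  (\<open>radius_admissible_lune\<close>). The total bounds are \<open>6 r / (1 - r\<^sup>2)\<close>, \<open>(5 r + r\<^sup>2) / (1 - r\<^sup>2)\<close> and
  \<open>4 r / (1 - r\<^sup>2)\<close>, and equating them with \<open>2 - sqrt 2\<close> gives the quadratic equations whose
  positive roots are the three stated numbers.

  For \<^const>\<open>class_G1\<close> and \<^const>\<open>class_G3\<close> the bounds are attained at \<open>z = -r\<close> by
  \<open>z ((1 + z) / (1 - z)) ^ n\<close> with \<open>n = 3\<close> and \<open>n = 2\<close>: there the starlike quotient hits the boundary
  point \<open>sqrt 2 - 1\<close> of the lune (\<open>radius_le_of_extremal\<close>). For \<^const>\<open>class_G2\<close> the largest
  admissible number is obtained as a supremum (\<open>is_radius_exists\<close>).
\<close>

section \<open>Logarithmic derivatives of Caratheodory functions\<close>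

lemma Moebius_function_has_field_derivative:
  assumes "1 - cnj c * x \<noteq> 0"
  shows "(Moebius_function 0 c has_field_derivative
           (1 - cnj c * c) / (1 - cnj c * x)\<^sup>2) (at x)"
  unfolding Moebius_function_simple[abs_def]
  using assms by (auto intro!: derivative_eq_intros simp: field_simps power2_eq_square)

lemma one_minus_cnj_mult_self: "1 - cnj c * c = of_real (1 - (cmod c)\<^sup>2)"
  by (simp add: complex_norm_square[symmetric] mult.commute)

text \<open>
  Conjugating \<open>w\<close> with disc automorphisms that carry \<open>a\<close> and \<open>w a\<close> to the origin reduces this to
  the estimate of the derivative at the origin in Schwarz's lemma.
\<close>

lemma Schwarz_Pick_deriv:
  assumes holw: "w holomorphic_on \<D>" and wD: "w ` \<D> \<subseteq> \<D>" and a: "a \<in> \<D>"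
  shows "cmod (deriv w a) * (1 - (cmod a)\<^sup>2) \<le> 1 - (cmod (w a))\<^sup>2"
proof -
  have "w a \<in> \<D>" using wD a by blast
  with a have a1: "cmod a < 1" and b1: "cmod (w a) < 1"
    by simp_all
  have sq: "(cmod a)\<^sup>2 < 1" "(cmod (w a))\<^sup>2 < 1"
    using a1 b1 by (simp_all add: power_less_one_iff)
  define g where "g = Moebius_function 0 (w a) \<circ> w \<circ> Moebius_function 0 (-a)"
  have wlt: "cmod (w z) < 1" if "cmod z < 1" for z
  proof -
    have "w z \<in> \<D>" by (rule subsetD[OF wD imageI]) (use that in simp)
    then show ?thesis by simp
  qed
  have Ma: "cmod (Moebius_function 0 (-a) z) < 1" if "cmod z < 1" for z
    using that a1 by (intro Moebius_function_norm_lt_1) auto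
  have holg: "g holomorphic_on \<D>"
    unfolding g_def
  proof (rule holomorphic_on_compose_gen[where t = \<D>])
    show "Moebius_function 0 (-a) holomorphic_on \<D>"
      using a1 by (intro Moebius_function_holomorphic) auto
    show "Moebius_function 0 (w a) \<circ> w holomorphic_on \<D>"
      by (rule holomorphic_on_compose_gen[OF holw Moebius_function_holomorphic wD])
         (use b1 in auto)
  qed (use Ma in auto)
  have M0: "Moebius_function 0 (-a) 0 = a"
    by (simp add: Moebius_function_of_zero)
  have g0: "g 0 = 0"
    by (simp add: g_def M0 Moebius_function_eq_zero)
  have glt: "cmod (g z) < 1" if "cmod z < 1" for z
    unfolding g_def o_def
    using a1 b1 by (intro Moebius_function_norm_lt_1 wlt Ma that) auto
  have nz: "1 - cnj (w a) * w a \<noteq> 0"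
    unfolding one_minus_cnj_mult_self of_real_eq_0_iff using sq by linarith
  have d1: "(Moebius_function 0 (-a) has_field_derivative of_real (1 - (cmod a)\<^sup>2)) (at 0)"
    using Moebius_function_has_field_derivative[of "-a" 0] one_minus_cnj_mult_self[of "-a"]
    by simp
  have d2: "(w has_field_derivative deriv w a) (at (Moebius_function 0 (-a) 0))"
    unfolding M0 using holw a by (intro holomorphic_derivI) auto
  have d3: "(Moebius_function 0 (w a) has_field_derivative
              (1 - cnj (w a) * w a) / (1 - cnj (w a) * w a)\<^sup>2)
              (at ((w \<circ> Moebius_function 0 (-a)) 0))"
    using Moebius_function_has_field_derivative[OF nz] by (simp add: M0)
  have deriv_g: "(g has_field_derivative (1 - cnj (w a) * w a) / (1 - cnj (w a) * w a)\<^sup>2 *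
           (deriv w a * of_real (1 - (cmod a)\<^sup>2))) (at 0)"
    unfolding g_def o_assoc[symmetric]
    by (rule DERIV_chain[OF d3 DERIV_chain[OF d2 d1]])
  have "k / k\<^sup>2 * x = x / k" if "k \<noteq> 0" for k x :: complex
    using that by (simp add: power2_eq_square)
  from DERIV_imp_deriv[OF deriv_g, unfolded this[OF nz]]
  have dg: "deriv g 0 = deriv w a * of_real (1 - (cmod a)\<^sup>2) / of_real (1 - (cmod (w a))\<^sup>2)"
    unfolding one_minus_cnj_mult_self .
  have "cmod (deriv g 0) \<le> 1"
    by (rule Schwarz_Lemma(2)[OF holg g0 glt, of 0]) auto
  then have "cmod (deriv w a) * \<bar>1 - (cmod a)\<^sup>2\<bar> / \<bar>1 - (cmod (w a))\<^sup>2\<bar> \<le> 1"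
    unfolding dg norm_divide norm_mult norm_of_real .
  then show ?thesis
    using sq by (simp add: field_simps)
qed

lemma class_P_nonzero: "p \<in> class_P \<Longrightarrow> z \<in> \<D> \<Longrightarrow> p z \<noteq> 0"
  unfolding class_P_def by fastforce

lemma class_P_holomorphic: "p \<in> class_P \<Longrightarrow> p holomorphic_on \<D>"
  unfolding class_P_def by blast

text \<open>
  The Cayley transform \<open>(p - 1) / (p + 1)\<close> maps the disc into itself, and the Schwarz-Pick
  inequality for it reads \<open>\<bar>p'\<bar> (1 - \<bar>z\<bar>\<^sup>2) \<le> 2 Re p\<close>.
\<close>

lemma class_P_logderiv_bound:
  assumes p: "p \<in> class_P" and z: "z \<in> \<D>"
  shows "cmod (z * deriv p z / p z) \<le> 2 * cmod z / (1 - (cmod z)\<^sup>2)"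
proof -
  have holp: "p holomorphic_on \<D>" and Re: "\<And>u. u \<in> \<D> \<Longrightarrow> Re (p u) > 0"
    using p by (auto simp: class_P_def)
  have nz: "p u + 1 \<noteq> 0" if "u \<in> \<D>" for u
  proof
    assume "p u + 1 = 0"
    then have "Re (p u + 1) = 0" by (simp only: zero_complex.sel)
    then show False using Re[OF that] by simp
  qed
  have pnz: "p z \<noteq> 0" using class_P_nonzero[OF p z] .
  define w where "w = (\<lambda>u. (p u - 1) / (p u + 1))"
  have sqdiff: "(cmod (p u + 1))\<^sup>2 - (cmod (p u - 1))\<^sup>2 = 4 * Re (p u)" for u
    unfolding cmod_power2 by (simp add: power2_eq_square algebra_simps)
  have "cmod (w u) < 1" if "u \<in> \<D>" for u
  proof -
    have "(cmod (p u - 1))\<^sup>2 < (cmod (p u + 1))\<^sup>2"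
      using sqdiff[of u] Re[OF that] by linarith
    then have "cmod (p u - 1) < cmod (p u + 1)"
      using power2_less_imp_less norm_ge_zero by blast
    then show ?thesis
      using nz[OF that] by (simp add: w_def norm_divide)
  qed
  then have wD: "w ` \<D> \<subseteq> \<D>" by auto
  have holw: "w holomorphic_on \<D>"
    unfolding w_def using nz by (intro holomorphic_intros holp) auto
  have "(p has_field_derivative deriv p z) (at z)"
    using holp z by (intro holomorphic_derivI) auto
  then have "(w has_field_derivative 2 * deriv p z / (p z + 1)\<^sup>2) (at z)"
    unfolding w_def using nz[OF z]
    by (auto intro!: derivative_eq_intros simp: field_simps power2_eq_square)
  then have dw: "deriv w z = 2 * deriv p z / (p z + 1)\<^sup>2"
    by (rule DERIV_imp_deriv)
  have pos: "(cmod (p z + 1))\<^sup>2 > 0"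
    using nz[OF z] by simp
  have "1 - (cmod (w z))\<^sup>2 = ((cmod (p z + 1))\<^sup>2 - (cmod (p z - 1))\<^sup>2) / (cmod (p z + 1))\<^sup>2"
    using pos by (simp add: w_def norm_divide power_divide field_simps)
  then have w2: "1 - (cmod (w z))\<^sup>2 = 4 * Re (p z) / (cmod (p z + 1))\<^sup>2"
    by (simp only: sqdiff)
  have "2 * cmod (deriv p z) / (cmod (p z + 1))\<^sup>2 * (1 - (cmod z)\<^sup>2)
          \<le> 4 * Re (p z) / (cmod (p z + 1))\<^sup>2"
    using Schwarz_Pick_deriv[OF holw wD z] unfolding w2 unfolding dw
    by (simp add: norm_divide norm_mult norm_power)
  then have "2 * cmod (deriv p z) * (1 - (cmod z)\<^sup>2) \<le> 4 * Re (p z)"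
    using pos by (simp add: divide_le_cancel)
  also have "\<dots> \<le> 4 * cmod (p z)"
    using complex_Re_le_cmod by simp
  finally have le: "cmod (deriv p z) * (1 - (cmod z)\<^sup>2) \<le> 2 * cmod (p z)"
    by simp
  have "(cmod z)\<^sup>2 < 1"
    using z by (simp add: power_less_one_iff)
  then have "cmod (deriv p z) / cmod (p z) \<le> 2 / (1 - (cmod z)\<^sup>2)"
    using le pnz by (simp add: field_simps)
  then have "cmod z * (cmod (deriv p z) / cmod (p z)) \<le> cmod z * (2 / (1 - (cmod z)\<^sup>2))"
    by (intro mult_left_mono) auto
  then show ?thesis
    by (simp add: norm_divide norm_mult mult.commute)
qed

text \<open>
  Here \<open>w = 1 - 1 / p\<close> is a self-map of the disc fixing the origin. Since
  \<open>1 - \<bar>w\<bar> \<le> \<bar>1 - w\<bar> = 1 / \<bar>p\<bar>\<close>, one factor of \<open>1 - \<bar>w\<bar>\<^sup>2\<close> in the Schwarz-Pick inequality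
  absorbs a power of \<open>p\<close>, and Schwarz's lemma bounds the other factor \<open>1 + \<bar>w\<bar>\<close> by \<open>1 + \<bar>z\<bar>\<close>.
\<close>

lemma class_P_half_logderiv_bound:
  assumes p: "p \<in> class_P_half" and z: "z \<in> \<D>"
  shows "cmod (z * deriv p z / p z) \<le> cmod z / (1 - cmod z)"
proof -
  have pP: "p \<in> class_P" and Re: "\<And>u. u \<in> \<D> \<Longrightarrow> Re (p u) > 1 / 2"
    using p by (auto simp: class_P_half_def)
  have holp: "p holomorphic_on \<D>" and p0: "p 0 = 1"
    using pP by (auto simp: class_P_def)
  note nz = class_P_nonzero[OF pP]
  define w where "w = (\<lambda>u. 1 - 1 / p u)"
  have wlt: "cmod (w u) < 1" if "u \<in> \<D>" for u
  proof -
    have "(cmod (p u))\<^sup>2 - (cmod (p u - 1))\<^sup>2 = 2 * Re (p u) - 1"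
      unfolding cmod_power2 by (simp add: power2_eq_square algebra_simps)
    then have "(cmod (p u - 1))\<^sup>2 < (cmod (p u))\<^sup>2"
      using Re[OF that] by linarith
    then have "cmod (p u - 1) < cmod (p u)"
      using power2_less_imp_less norm_ge_zero by blast
    moreover have "w u = (p u - 1) / p u"
      using nz[OF that] by (simp add: w_def field_simps)
    ultimately show ?thesis
      using nz[OF that] by (simp add: norm_divide)
  qed
  then have wD: "w ` \<D> \<subseteq> \<D>" by auto
  have holw: "w holomorphic_on \<D>"
    unfolding w_def using nz by (intro holomorphic_intros holp) auto
  have w0: "w 0 = 0" by (simp add: w_def p0)
  have r1: "cmod z < 1" using z by simp
  have wle: "cmod (w z) \<le> cmod z"
    using Schwarz_Lemma(1)[OF holw w0 _ r1] wlt by simp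
  have "(p has_field_derivative deriv p z) (at z)"
    using holp z by (intro holomorphic_derivI) auto
  then have "(w has_field_derivative deriv p z / (p z)\<^sup>2) (at z)"
    unfolding w_def using nz[OF z]
    by (auto intro!: derivative_eq_intros simp: field_simps power2_eq_square)
  then have dw: "deriv w z = deriv p z / (p z)\<^sup>2"
    by (rule DERIV_imp_deriv)
  have pos: "cmod (p z) > 0" using nz[OF z] by simp
  have "1 - cmod (w z) \<le> cmod (1 - w z)"
    by (metis norm_one norm_triangle_ineq2)
  also have "\<dots> = 1 / cmod (p z)"
    by (simp add: w_def norm_divide)
  finally have one: "(1 - cmod (w z)) * cmod (p z) \<le> 1"
    using pos by (simp add: field_simps)
  have "cmod (deriv p z) / (cmod (p z))\<^sup>2 * (1 - (cmod z)\<^sup>2) \<le> 1 - (cmod (w z))\<^sup>2"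
    using Schwarz_Pick_deriv[OF holw wD z] by (simp add: dw norm_divide norm_power)
  then have "cmod (deriv p z) / cmod (p z) * (1 - (cmod z)\<^sup>2)
               \<le> (1 - (cmod (w z))\<^sup>2) * cmod (p z)"
    using pos by (simp add: power2_eq_square field_simps)
  also have "\<dots> = ((1 - cmod (w z)) * cmod (p z)) * (1 + cmod (w z))"
    by (simp add: power2_eq_square algebra_simps)
  also have "\<dots> \<le> 1 * (1 + cmod z)"
    using one wle wlt[OF z] pos by (intro mult_mono) auto
  finally have "cmod (deriv p z) / cmod (p z) * (1 - cmod z) * (1 + cmod z) \<le> 1 + cmod z"
    by (simp add: power2_eq_square algebra_simps)
  moreover have "1 + cmod z > 0"
    using norm_ge_zero[of z] by linarith
  ultimately have "cmod (deriv p z) / cmod (p z) * (1 - cmod z) \<le> 1"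
    using mult_right_le_imp_le[of "cmod (deriv p z) / cmod (p z) * (1 - cmod z)" "1 + cmod z" 1]
    by simp
  then have "cmod (deriv p z) / cmod (p z) \<le> 1 / (1 - cmod z)"
    using r1 by (simp add: pos_le_divide_eq)
  then have "cmod z * (cmod (deriv p z) / cmod (p z)) \<le> cmod z * (1 / (1 - cmod z))"
    by (intro mult_left_mono) auto
  then show ?thesis
    by (simp add: norm_divide norm_mult)
qed

lemma logderiv_mult:
  assumes "p holomorphic_on \<D>" "q holomorphic_on \<D>" "z \<in> \<D>" "p z \<noteq> 0" "q z \<noteq> 0"
  shows "z * deriv (\<lambda>u. p u * q u) z / (p z * q z) = z * deriv p z / p z + z * deriv q z / q z"
proof -
  have "(p has_field_derivative deriv p z) (at z)" "(q has_field_derivative deriv q z) (at z)"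
    using assms by (auto intro!: holomorphic_derivI)
  then have "((\<lambda>u. p u * q u) has_field_derivative deriv p z * q z + deriv q z * p z) (at z)"
    by (rule DERIV_mult)
  then have "deriv (\<lambda>u. p u * q u) z = deriv p z * q z + deriv q z * p z"
    by (rule DERIV_imp_deriv)
  then show ?thesis
    using assms by (simp add: field_simps)
qed

section \<open>Factorisation of the three classes\<close>

lemma remove_sings_eq_on_disc:
  assumes H: "H holomorphic_on \<D>" and eq: "\<And>z. z \<in> \<D> \<Longrightarrow> z \<noteq> 0 \<Longrightarrow> F z = H z"
    and z: "z \<in> \<D>"
  shows "remove_sings F z = H z"
proof (rule remove_sings_eqI)
  have "isCont H z"
    using H z by (meson continuous_on_eq_continuous_at holomorphic_on_imp_continuous_on open_ball)
  then have lim: "H \<midarrow>z\<rightarrow> H z"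
    by (simp add: isCont_def)
  (* The exceptional point 0 is excluded by the punctured neighbourhood when z = 0,
     and by shrinking the neighbourhood otherwise. *)
  have "open (\<D> - ({0} - {z}))"
    by (intro open_Diff finite_imp_closed) auto
  then have "eventually (\<lambda>u. u \<in> \<D> - ({0} - {z})) (nhds z)"
    using z by (intro eventually_nhds_in_open) auto
  then have "eventually (\<lambda>u. u \<in> \<D> - ({0} - {z}) - {z}) (at z)"
    unfolding eventually_at_filter by eventually_elim auto
  then have "eventually (\<lambda>u. H u = F u) (at z)"
    by eventually_elim (use eq in auto)
  with lim show "F \<midarrow>z\<rightarrow> H z"
    using Lim_transform_eventually by blast
qed

lemma remove_sings_in_class_P:
  assumes H: "H \<in> class_P" and eq: "\<And>z. z \<in> \<D> \<Longrightarrow> z \<noteq> 0 \<Longrightarrow> F z = H z"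
  shows "remove_sings F \<in> class_P"
proof -
  have rs: "remove_sings F z = H z" if "z \<in> \<D>" for z
    using remove_sings_eq_on_disc[OF class_P_holomorphic[OF H] eq that] .
  then have "remove_sings F holomorphic_on \<D>"
    using class_P_holomorphic[OF H] holomorphic_cong by blast
  with rs H show ?thesis
    by (simp add: class_P_def)
qed

lemma remove_sings_quotient_mult:
  assumes "f holomorphic_on \<D>" "g holomorphic_on \<D>" "z \<in> \<D>" "g z \<noteq> 0"
  shows "f z = remove_sings (\<lambda>u. f u / g u) z * g z"
proof -
  have "f analytic_on {z}" "g analytic_on {z}"
    using assms by (meson analytic_at open_ball)+
  then have "(\<lambda>u. f u / g u) analytic_on {z}"
    using assms(4) by (intro analytic_intros) auto
  then show ?thesis
    using assms(4) by simp
qed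

lemma class_A_holomorphic: "f \<in> class_A \<Longrightarrow> f holomorphic_on \<D>"
  and class_A_zero: "f \<in> class_A \<Longrightarrow> f 0 = 0"
  by (auto simp: class_A_def)

lemma factor_over_class_P:
  assumes f: "f \<in> class_A" and p: "p \<in> class_P"
    and z: "z \<in> \<D>"
  shows "f z = z * (p z * remove_sings (\<lambda>u. f u / (u * p u)) z)"
proof (cases "z = 0")
  case True
  then show ?thesis using class_A_zero[OF f] by simp
next
  case False
  have "f z = remove_sings (\<lambda>u. f u / (u * p u)) z * (z * p z)"
    using False class_P_nonzero[OF p z]
    by (intro remove_sings_quotient_mult class_A_holomorphic f holomorphic_intros
        class_P_holomorphic p z) auto
  then show ?thesis by (simp add: mult_ac)
qed

text \<open>
  The zeros of \<open>g\<close> could obstruct solving \<open>f / g = h\<close> for \<open>f\<close>; but the factorisation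
  \<open>g = z p k\<close> shows that \<open>g\<close> vanishes only at the origin.
\<close>

lemma factor_over_intermediate:
  assumes f: "f \<in> class_A" and g: "g \<in> class_A" and p: "p \<in> class_P"
    and k: "remove_sings (\<lambda>z. g z / (z * p z)) \<in> class_P" (is "?k \<in> _")
    and z: "z \<in> \<D>"
  shows "f z = z * (p z * remove_sings (\<lambda>z. f z / g z) z * ?k z)"
proof (cases "z = 0")
  case True
  then show ?thesis using class_A_zero[OF f] by simp
next
  case False
  have gz: "g z = z * (p z * ?k z)"
    using factor_over_class_P[OF g p z] .
  then have "g z \<noteq> 0"
    using False class_P_nonzero[OF p z] class_P_nonzero[OF k z] by simp
  then have "f z = remove_sings (\<lambda>z. f z / g z) z * g z"
    by (rule remove_sings_quotient_mult[OF class_A_holomorphic[OF f] class_A_holomorphic[OF g] z])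
  also have "\<dots> = z * (p z * remove_sings (\<lambda>z. f z / g z) z * ?k z)"
    by (subst gz) (simp add: mult_ac)
  finally show ?thesis .
qed

section \<open>The lune and scaled functions\<close>

text \<open>
  The lune is the set \<open>\<bar>W - 1\<bar> < sqrt 2 < \<bar>W + 1\<bar>\<close>, so the largest disc about 1 inside it has
  radius \<open>2 - sqrt 2\<close>. On the right half plane the Joukowski-type map \<open>W \<mapsto> (W - 1/W) / 2\<close>
  inverts \<^const>\<open>lune_fun\<close>.
\<close>

lemma lune_inverse:
  assumes W: "cmod (W - 1) < 2 - sqrt 2"
  shows "W \<noteq> 0" "cmod ((W\<^sup>2 - 1) / (2 * W)) < 1" "lune_fun ((W\<^sup>2 - 1) / (2 * W)) = W"
proof -
  define s where "s = sqrt 2"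
  have s2: "s\<^sup>2 = 2" and s0: "s > 1"
    by (simp_all add: s_def)
  have W': "cmod (W - 1) < 2 - s" using W by (simp add: s_def)
  then have "\<bar>Re (W - 1)\<bar> < 1"
    using abs_Re_le_cmod[of "W - 1"] s0 by linarith
  then have ReW: "Re W > 0" by (simp add: abs_less_iff)
  then show W0: "W \<noteq> 0" by auto
  have "(cmod (W - 1))\<^sup>2 < 2"
  proof -
    have "cmod (W - 1) < s"
      using W' s2 s0 by (smt (verit) power2_eq_square mult_less_cancel_right)
    then have "(cmod (W - 1))\<^sup>2 < s\<^sup>2"
      by (intro power_strict_mono) auto
    then show ?thesis using s2 by simp
  qed
  moreover have "(cmod (W + 1))\<^sup>2 > 2"
  proof -
    have "cmod (W + 1 - (W - 1)) = 2"
      by simp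
    then have "2 \<le> cmod (W + 1) + cmod (W - 1)"
      using norm_triangle_ineq4[of "W + 1" "W - 1"] by linarith
    then have "cmod (W + 1) > s"
      using W' by linarith
    then have "(cmod (W + 1))\<^sup>2 > s\<^sup>2"
      using s0 by (intro power_strict_mono) auto
    then show ?thesis using s2 by simp
  qed
  ultimately have neg: "((cmod (W - 1))\<^sup>2 - 2) * ((cmod (W + 1))\<^sup>2 - 2) < 0"
    by (simp add: mult_less_0_iff)
  have "((cmod (W - 1))\<^sup>2 - 2) * ((cmod (W + 1))\<^sup>2 - 2) = (cmod (W\<^sup>2 - 1))\<^sup>2 - (2 * cmod W)\<^sup>2"
    unfolding power_mult_distrib cmod_power2
    by (simp add: power2_eq_square algebra_simps)
  with neg have "(cmod (W\<^sup>2 - 1))\<^sup>2 < (2 * cmod W)\<^sup>2"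
    by linarith
  then have "cmod (W\<^sup>2 - 1) < 2 * cmod W"
    by (rule power2_less_imp_less) simp
  then show "cmod ((W\<^sup>2 - 1) / (2 * W)) < 1"
    using W0 by (simp add: norm_divide norm_mult)
  have "csqrt (1 + ((W\<^sup>2 - 1) / (2 * W))\<^sup>2) = (W + 1 / W) / 2"
  proof (rule csqrt_unique)
    show "((W + 1 / W) / 2)\<^sup>2 = 1 + ((W\<^sup>2 - 1) / (2 * W))\<^sup>2"
      using W0 by (simp add: field_simps power2_eq_square)
    have "Re (1 / W) \<ge> 0"
      using ReW by (simp add: Re_divide)
    then show "0 < Re ((W + 1 / W) / 2) \<or> Re ((W + 1 / W) / 2) = 0 \<and> 0 \<le> Im ((W + 1 / W) / 2)"
      using ReW by simp
  qed
  then show "lune_fun ((W\<^sup>2 - 1) / (2 * W)) = W"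
    using W0 by (simp add: lune_fun_def field_simps power2_eq_square)
qed

text \<open>
  \<open>sqrt 2 - 1\<close> is the point where the boundary of the lune meets the real segment to the left
  of 1; it is attained only at the boundary point \<open>-1\<close> of the disc.
\<close>

lemma lune_fun_eq_leftmost:
  assumes "lune_fun u = of_real (sqrt 2 - 1)"
  shows "u = -1"
proof -
  define c where "c = complex_of_real (sqrt 2 - 1)"
  have c0: "c \<noteq> 0" by (simp add: c_def)
  have "(sqrt 2 - 1)\<^sup>2 = 1 - 2 * (sqrt 2 - 1)"
    by (simp add: power2_eq_square algebra_simps)
  then have c2: "c\<^sup>2 = 1 - 2 * c"
    unfolding c_def by (metis of_real_1 of_real_diff of_real_mult of_real_numeral of_real_power)
  have "csqrt (1 + u\<^sup>2) = c - u"
    using assms by (simp add: lune_fun_def c_def algebra_simps)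
  then have "1 + u\<^sup>2 = (c - u)\<^sup>2"
    by (metis power2_csqrt)
  also have "\<dots> = c\<^sup>2 - 2 * c * u + u\<^sup>2"
    by (simp add: power2_eq_square algebra_simps)
  finally have "2 * c * (u + 1) = 0"
    using c2 by (simp add: algebra_simps)
  with c0 have "u + 1 = 0" by simp
  then show ?thesis by (simp add: eq_neg_iff_add_eq_0)
qed

lemma remove_sings_starlike_quotient:
  assumes P: "P holomorphic_on \<D>" "\<And>z. z \<in> \<D> \<Longrightarrow> P z \<noteq> 0"
    and f: "\<And>z. z \<in> \<D> \<Longrightarrow> f z = z * P z" and z: "z \<in> \<D>"
  shows "remove_sings (\<lambda>z. z * deriv f z / f z) z = 1 + z * deriv P z / P z"
proof (rule remove_sings_eq_on_disc[OF _ _ z])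
  show "(\<lambda>z. 1 + z * deriv P z / P z) holomorphic_on \<D>"
    using P by (intro holomorphic_intros) auto
  fix u :: complex assume u: "u \<in> \<D>" "u \<noteq> 0"
  have "(P has_field_derivative deriv P u) (at u)"
    using P u by (intro holomorphic_derivI) auto
  then have "((\<lambda>z. z * P z) has_field_derivative P u + u * deriv P u) (at u)"
    by (auto intro!: derivative_eq_intros)
  then have "(f has_field_derivative P u + u * deriv P u) (at u)"
    by (rule has_field_derivative_transform_within_open[where S = \<D>]) (use f u in auto)
  then have "deriv f u = P u + u * deriv P u"
    by (rule DERIV_imp_deriv)
  then show "u * deriv f u / f u = 1 + u * deriv P u / P u"
    using f[OF u(1)] P(2)[OF u(1)] u(2) by (simp add: field_simps)
qed

lemma scaled_in_disc:
  assumes "0 < r" "r < 1" "z \<in> \<D>"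
  shows "of_real r * z \<in> \<D>"
proof -
  have "r * cmod z \<le> r"
    using assms by (intro mult_left_le) auto
  moreover have "cmod (of_real r * z) = r * cmod z"
    using assms by (simp add: norm_mult)
  ultimately show ?thesis
    using assms unfolding mem_ball_0 by linarith
qed

lemma scaled_in_class_A:
  assumes f: "f \<in> class_A" and r: "0 < r" "r < 1"
  shows "(\<lambda>z. f (of_real r * z) / of_real r) \<in> class_A"
proof -
  have hol: "f holomorphic_on \<D>" and f0: "f 0 = 0" and d0: "deriv f 0 = 1"
    using f by (auto simp: class_A_def)
  have "(f \<circ> (\<lambda>z. of_real r * z)) holomorphic_on \<D>"
    by (rule holomorphic_on_compose_gen[OF _ hol])
       (use scaled_in_disc[OF r] in \<open>auto intro!: holomorphic_intros\<close>)
  then have "(\<lambda>z. f (of_real r * z) / of_real r) holomorphic_on \<D>"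
    using r by (intro holomorphic_intros) (auto simp: o_def)
  moreover have "((\<lambda>z. f (of_real r * z) / of_real r) has_field_derivative 1) (at 0)"
  proof -
    have "(f has_field_derivative 1) (at (of_real r * 0))"
      using holomorphic_derivI[OF hol, of 0] d0 by simp
    moreover have "((\<lambda>z. of_real r * z) has_field_derivative of_real r) (at 0)"
      by (auto intro!: derivative_eq_intros)
    ultimately have "((\<lambda>z. f (of_real r * z)) has_field_derivative 1 * of_real r) (at 0)"
      by (rule DERIV_chain2)
    from DERIV_cdivide[OF this, of "of_real r"] show ?thesis using r by simp
  qed
  ultimately show ?thesis
    using f0 by (simp add: class_A_def DERIV_imp_deriv)
qed

lemma scaled_starlike_quotient:
  assumes P: "P holomorphic_on \<D>" "\<And>z. z \<in> \<D> \<Longrightarrow> P z \<noteq> 0"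
    and f: "\<And>z. z \<in> \<D> \<Longrightarrow> f z = z * P z" and r: "0 < r" "r < 1" and z: "z \<in> \<D>"
  defines "fr \<equiv> \<lambda>z. f (of_real r * z) / of_real r"
  shows "remove_sings (\<lambda>z. z * deriv fr z / fr z) z
           = 1 + (of_real r * z) * deriv P (of_real r * z) / P (of_real r * z)"
proof -
  define Q where "Q = (\<lambda>z. P (of_real r * z))"
  note rD = scaled_in_disc[OF r]
  have "(P \<circ> (\<lambda>z. of_real r * z)) holomorphic_on \<D>"
    by (rule holomorphic_on_compose_gen[OF _ P(1)])
       (use rD in \<open>auto intro!: holomorphic_intros\<close>)
  then have holQ: "Q holomorphic_on \<D>"
    by (simp add: Q_def o_def)
  have "(P has_field_derivative deriv P (of_real r * z)) (at (of_real r * z))"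
    using holomorphic_derivI[OF P(1) _ rD[OF z]] by simp
  moreover have "((\<lambda>z. of_real r * z) has_field_derivative of_real r) (at z)"
    by (auto intro!: derivative_eq_intros)
  ultimately have "(Q has_field_derivative deriv P (of_real r * z) * of_real r) (at z)"
    unfolding Q_def by (rule DERIV_chain2)
  then have dQ: "deriv Q z = deriv P (of_real r * z) * of_real r"
    by (rule DERIV_imp_deriv)
  have "remove_sings (\<lambda>z. z * deriv fr z / fr z) z = 1 + z * deriv Q z / Q z"
  proof (rule remove_sings_starlike_quotient[OF holQ _ _ z])
    show "Q u \<noteq> 0" if "u \<in> \<D>" for u
      using P(2)[OF rD[OF that]] by (simp add: Q_def)
    show "fr u = u * Q u" if "u \<in> \<D>" for u
      using f[OF rD[OF that]] r by (simp add: fr_def Q_def)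
  qed
  then show ?thesis
    unfolding dQ by (simp add: Q_def mult_ac)
qed

text \<open>
  The subordinating function is explicit: the inverse of the lune map applied to the starlike
  quotient, which the bound on the logarithmic derivative keeps in the disc of
  \<open>lune_inverse\<close>.
\<close>

lemma radius_admissible_lune:
  assumes R: "0 < R" "R < 1" and F: "F \<subseteq> class_A"
    and fac: "\<And>f. f \<in> F \<Longrightarrow> \<exists>P. P holomorphic_on \<D> \<and> (\<forall>z\<in>\<D>. P z \<noteq> 0 \<and> f z = z * P z \<and>
                 (cmod z < R \<longrightarrow> cmod (z * deriv P z / P z) < 2 - sqrt 2))"
  shows "radius_admissible class_S_lune F R"
  unfolding radius_admissible_def
proof (intro conjI ballI allI impI R)
  fix f r assume fF: "f \<in> F" and "0 < r \<and> r < R"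
  then have r: "0 < r" "r < R" "r < 1" using R by auto
  define fr where "fr = (\<lambda>z. f (of_real r * z) / of_real r)"
  obtain P where P: "P holomorphic_on \<D>" "\<And>z. z \<in> \<D> \<Longrightarrow> P z \<noteq> 0"
    and f: "\<And>z. z \<in> \<D> \<Longrightarrow> f z = z * P z"
    and bd: "\<And>z. z \<in> \<D> \<Longrightarrow> cmod z < R \<Longrightarrow> cmod (z * deriv P z / P z) < 2 - sqrt 2"
    using fac[OF fF] by blast
  define W where "W = remove_sings (\<lambda>z. z * deriv fr z / fr z)"
  have Weq: "W z = 1 + (of_real r * z) * deriv P (of_real r * z) / P (of_real r * z)"
    if "z \<in> \<D>" for z
    unfolding W_def fr_def
    using scaled_starlike_quotient[OF P f r(1) r(3) that] by simp
  note rD = scaled_in_disc[OF r(1) r(3)]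
  have Wbd: "cmod (W z - 1) < 2 - sqrt 2" if z: "z \<in> \<D>" for z
  proof -
    have "cmod (of_real r * z) < R"
    proof -
      have "r * cmod z \<le> r"
        using z r by (intro mult_left_le) auto
      moreover have "cmod (of_real r * z) = r * cmod z"
        using r by (simp add: norm_mult)
      ultimately show ?thesis using r by linarith
    qed
    then show ?thesis
      using bd[OF rD[OF z]] by (simp add: Weq[OF z])
  qed
  define H where "H = (\<lambda>z. 1 + z * deriv P z / P z)"
  have "H holomorphic_on \<D>"
    unfolding H_def using P by (intro holomorphic_intros) auto
  then have "(H \<circ> (\<lambda>z. of_real r * z)) holomorphic_on \<D>"
    by (rule holomorphic_on_compose_gen[rotated])
       (use rD in \<open>auto intro!: holomorphic_intros\<close>)
  then have holW: "W holomorphic_on \<D>"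
    by (rule holomorphic_transform) (simp add: H_def Weq)
  have W0: "W 0 = 1" using Weq[of 0] by simp
  define w where "w = (\<lambda>z. ((W z)\<^sup>2 - 1) / (2 * W z))"
  have "w holomorphic_on \<D>"
    unfolding w_def using lune_inverse(1)[OF Wbd] by (intro holomorphic_intros holW) auto
  moreover have "w ` \<D> \<subseteq> \<D>"
    using lune_inverse(2)[OF Wbd] by (auto simp: w_def)
  moreover have "w 0 = 0" by (simp add: w_def W0)
  moreover have "\<forall>z\<in>\<D>. W z = lune_fun (w z)"
    using lune_inverse(3)[OF Wbd] by (simp add: w_def)
  ultimately have "W \<prec>\<^sub>s lune_fun"
    unfolding subordinate_def using holW lune_fun_admissible(1) by blast
  moreover have "fr \<in> class_A"
    unfolding fr_def using fF F r by (intro scaled_in_class_A) auto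
  ultimately show "(\<lambda>z. f (of_real r * z) / of_real r) \<in> class_S_lune"
    by (simp add: class_S_lune_def starlike_class_def W_def fr_def)
qed

section \<open>Extremal functions\<close>

definition half_plane_map :: "complex \<Rightarrow> complex"
  where "half_plane_map z = (1 + z) / (1 - z)"

definition extremal :: "nat \<Rightarrow> complex \<Rightarrow> complex"
  where "extremal n z = z * half_plane_map z ^ n"

lemma one_minus_nonzero_on_disc: "z \<in> \<D> \<Longrightarrow> 1 - z \<noteq> 0" for z :: complex
  by auto

lemma half_plane_map_in_class_P: "half_plane_map \<in> class_P"
proof -
  have "half_plane_map holomorphic_on \<D>"
    unfolding half_plane_map_def using one_minus_nonzero_on_disc by (auto intro!: holomorphic_intros)
  moreover have "Re (half_plane_map z) > 0" if z: "z \<in> \<D>" for z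
  proof -
    have "(cmod z)\<^sup>2 < 1"
      using z by (simp add: power_less_one_iff)
    then have "(Re z)\<^sup>2 + (Im z)\<^sup>2 < 1"
      by (simp add: cmod_power2)
    moreover have "(1 - Re z)\<^sup>2 + (Im z)\<^sup>2 > 0"
      using one_minus_nonzero_on_disc[OF z]
      by (auto simp: complex_eq_iff sum_power2_gt_zero_iff)
    ultimately show ?thesis
      by (simp add: half_plane_map_def Re_divide field_simps power2_eq_square)
  qed
  ultimately show ?thesis
    by (simp add: class_P_def half_plane_map_def)
qed

lemma half_plane_map_power_holomorphic: "(\<lambda>z. half_plane_map z ^ n) holomorphic_on \<D>"
  by (intro holomorphic_intros class_P_holomorphic half_plane_map_in_class_P)

lemma half_plane_map_power_nonzero: "z \<in> \<D> \<Longrightarrow> half_plane_map z ^ n \<noteq> 0"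
  using class_P_nonzero[OF half_plane_map_in_class_P] by simp

lemma half_plane_map_power_logderiv:
  assumes z: "z \<in> \<D>"
  shows "z * deriv (\<lambda>u. half_plane_map u ^ n) z / half_plane_map z ^ n
           = 2 * of_nat n * z / (1 - z\<^sup>2)"
proof -
  have nz: "1 - z \<noteq> 0" "1 + z \<noteq> 0"
    using z one_minus_nonzero_on_disc[of z] one_minus_nonzero_on_disc[of "-z"] by auto
  have d: "deriv half_plane_map z = 2 / (1 - z)\<^sup>2"
    unfolding half_plane_map_def[abs_def]
    by (rule DERIV_imp_deriv)
       (use nz in \<open>auto intro!: derivative_eq_intros simp: field_simps power2_eq_square\<close>)
  have fac: "1 - z\<^sup>2 = (1 - z) * (1 + z)"
    by (simp add: power2_eq_square algebra_simps)
  have one: "z * deriv half_plane_map z / half_plane_map z = 2 * z / (1 - z\<^sup>2)"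
  proof -
    have "z * (2 / a\<^sup>2) / (b / a) = 2 * z / (a * b)" if "a \<noteq> 0" "b \<noteq> 0" for a b :: complex
      using that by (simp add: field_simps power2_eq_square)
    from this[OF nz] show ?thesis
      by (simp only: d fac half_plane_map_def)
  qed
  show ?thesis
  proof (induction n)
    case (Suc n)
    have "z * deriv (\<lambda>u. half_plane_map u ^ Suc n) z / half_plane_map z ^ Suc n
            = 2 * z / (1 - z\<^sup>2) + 2 * of_nat n * z / (1 - z\<^sup>2)"
      using logderiv_mult[OF class_P_holomorphic[OF half_plane_map_in_class_P]
          half_plane_map_power_holomorphic z
          class_P_nonzero[OF half_plane_map_in_class_P z] half_plane_map_power_nonzero[OF z]]
      unfolding one Suc.IH[symmetric] power_Suc .
    also have "\<dots> = 2 * of_nat (Suc n) * z / (1 - z\<^sup>2)"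
      by (simp add: add_divide_distrib[symmetric] algebra_simps)
    finally show ?case .
  qed simp
qed

lemma extremal_in_class_A: "extremal n \<in> class_A"
proof -
  have "((\<lambda>z. half_plane_map z ^ n) has_field_derivative deriv (\<lambda>z. half_plane_map z ^ n) 0) (at 0)"
    by (rule holomorphic_derivI[OF half_plane_map_power_holomorphic]) auto
  then have "((\<lambda>z. z * half_plane_map z ^ n) has_field_derivative 1) (at 0)"
    by (auto intro!: derivative_eq_intros simp: half_plane_map_def)
  then have "deriv (extremal n) 0 = 1"
    unfolding extremal_def[abs_def] by (rule DERIV_imp_deriv)
  moreover have "extremal n holomorphic_on \<D>"
    unfolding extremal_def[abs_def]
    by (intro holomorphic_intros half_plane_map_power_holomorphic)
  ultimately show ?thesis
    by (simp add: class_A_def extremal_def)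
qed

lemma extremal_divide:
  assumes "z \<in> \<D>" "z \<noteq> 0"
  shows "extremal (Suc n) z / extremal n z = half_plane_map z"
    and "extremal (Suc n) z / (z * half_plane_map z) = half_plane_map z ^ n"
  using assms class_P_nonzero[OF half_plane_map_in_class_P assms(1)]
  by (simp_all add: extremal_def)

lemma extremal_in_G1: "extremal 3 \<in> class_G1"
proof -
  have "remove_sings (\<lambda>z. extremal 3 z / extremal 2 z) \<in> class_P"
    by (rule remove_sings_in_class_P[OF half_plane_map_in_class_P])
       (use extremal_divide(1)[where n = 2] in \<open>simp add: numeral_3_eq_3 numeral_2_eq_2\<close>)
  moreover have "remove_sings (\<lambda>z. extremal 2 z / (z * half_plane_map z)) \<in> class_P"
    by (rule remove_sings_in_class_P[OF half_plane_map_in_class_P])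
       (use extremal_divide(2)[where n = 1] in \<open>simp add: numeral_2_eq_2\<close>)
  ultimately show ?thesis
    unfolding class_G1_def using extremal_in_class_A half_plane_map_in_class_P by blast
qed

lemma extremal_in_G3: "extremal 2 \<in> class_G3"
proof -
  have "remove_sings (\<lambda>z. extremal 2 z / (z * half_plane_map z)) \<in> class_P"
    by (rule remove_sings_in_class_P[OF half_plane_map_in_class_P])
       (use extremal_divide(2)[where n = 1] in \<open>simp add: numeral_2_eq_2\<close>)
  then show ?thesis
    unfolding class_G3_def using extremal_in_class_A half_plane_map_in_class_P by blast
qed

text \<open>
  Taking the second Caratheodory factor to be constantly 1 places the extremal function of
  \<^const>\<open>class_G3\<close> in \<^const>\<open>class_G2\<close> as well. This keeps the admissible numbers for
  \<^const>\<open>class_G2\<close> below a bound less than 1, without which there would be no largest one.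
\<close>

lemma extremal_in_G2: "extremal 2 \<in> class_G2"
proof -
  let ?k = "remove_sings (\<lambda>z. extremal 1 z / (z * half_plane_map z))"
  have one: "(\<lambda>_. 1) \<in> class_P" by (simp add: class_P_def)
  have eq: "extremal 1 z / (z * half_plane_map z) = 1" if "z \<in> \<D>" "z \<noteq> 0" for z
    using extremal_divide(2)[OF that, of 0] by simp
  have "?k \<in> class_P"
    by (rule remove_sings_in_class_P[OF one eq])
  moreover have "?k z = 1" if "z \<in> \<D>" for z
    by (rule remove_sings_eq_on_disc[OF class_P_holomorphic[OF one] eq that])
  ultimately have "?k \<in> class_P_half"
    by (simp add: class_P_half_def)
  moreover have "remove_sings (\<lambda>z. extremal 2 z / extremal 1 z) \<in> class_P"
    by (rule remove_sings_in_class_P[OF half_plane_map_in_class_P])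
       (use extremal_divide(1)[where n = 1] in \<open>simp add: numeral_2_eq_2\<close>)
  ultimately show ?thesis
    unfolding class_G2_def using extremal_in_class_A half_plane_map_in_class_P by blast
qed

text \<open>
  At \<open>z = -R\<close> the starlike quotient \<open>1 + 2 n z / (1 - z\<^sup>2)\<close> of the extremal function reaches
  the boundary point \<open>sqrt 2 - 1\<close> of the lune, so no scaling factor beyond \<open>R\<close> is possible.
\<close>

lemma radius_le_of_extremal:
  assumes ext: "extremal n \<in> F" and R: "0 < R" "R < 1"
    and eq: "2 * real n * R / (1 - R\<^sup>2) = 2 - sqrt 2"
    and adm: "radius_admissible class_S_lune F R'"
  shows "R' \<le> R"
proof (rule ccontr)
  assume "\<not> R' \<le> R"
  then have less: "R < R'" by simp
  define r where "r = (R + R') / 2"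
  have R': "R' < 1" using adm by (simp add: radius_admissible_def)
  have r: "0 < r" "R < r" "r < R'" "r < 1"
    using less R R' by (auto simp: r_def)
  define fr where "fr = (\<lambda>z. extremal n (of_real r * z) / of_real r)"
  have "fr \<in> class_S_lune"
    unfolding fr_def using adm ext r by (auto simp: radius_admissible_def)
  then obtain w where w: "w ` \<D> \<subseteq> \<D>"
      and weq: "\<And>z. z \<in> \<D> \<Longrightarrow> remove_sings (\<lambda>z. z * deriv fr z / fr z) z = lune_fun (w z)"
    by (auto simp: class_S_lune_def starlike_class_def subordinate_def)
  define z where "z = complex_of_real (- (R / r))"
  have z: "z \<in> \<D>" using R r by (simp add: z_def norm_divide)
  have rz: "of_real r * z = - of_real R" using r by (simp add: z_def)
  have mR: "- of_real R \<in> \<D>" using R by simp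
  have "lune_fun (w z) = 1 + (of_real r * z) * deriv (\<lambda>u. half_plane_map u ^ n) (of_real r * z)
                             / half_plane_map (of_real r * z) ^ n"
    unfolding weq[OF z, symmetric] fr_def
    by (rule scaled_starlike_quotient[OF half_plane_map_power_holomorphic
          half_plane_map_power_nonzero extremal_def r(1) r(4) z])
  also have "\<dots> = 1 + 2 * of_nat n * (- of_real R) / (1 - (- of_real R)\<^sup>2)"
    unfolding rz half_plane_map_power_logderiv[OF mR] ..
  also have "\<dots> = of_real (1 - 2 * real n * R / (1 - R\<^sup>2))"
    by simp
  also have "\<dots> = of_real (sqrt 2 - 1)"
    unfolding eq by simp
  finally have "w z = -1"
    by (rule lune_fun_eq_leftmost)
  moreover have "w z \<in> \<D>" using w z by blast
  ultimately show False by simp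
qed

section \<open>The radii\<close>

text \<open>
  The fraction is the positive root \<open>(sqrt (b\<^sup>2 + 4 a c) - b) / (2 a)\<close> with its numerator
  rationalised.
\<close>

lemma positive_root_quadratic:
  fixes a b c :: real
  assumes "a > 0" "b > 0" "c > 0"
  defines "R \<equiv> 2 * c / (b + sqrt (b\<^sup>2 + 4 * a * c))"
  shows "R > 0" "a * R\<^sup>2 + b * R = c"
proof -
  define s where "s = sqrt (b\<^sup>2 + 4 * a * c)"
  have s2: "s\<^sup>2 = b\<^sup>2 + 4 * a * c" and s0: "s \<ge> 0"
    using assms by (simp_all add: s_def)
  have pos: "b + s > 0" using assms(2) s0 by linarith
  have R: "R = 2 * c / (b + s)" by (simp add: R_def s_def)
  show "R > 0" using assms(3) pos by (simp add: R)
  have "a * (2 * c / t)\<^sup>2 + b * (2 * c / t) = (4 * a * c\<^sup>2 + 2 * b * c * t) / t\<^sup>2"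
    if "t > 0" for t
    using that by (simp add: field_simps power2_eq_square)
  from this[OF pos]
  have "a * R\<^sup>2 + b * R = (4 * a * c\<^sup>2 + 2 * b * c * (b + s)) / (b + s)\<^sup>2"
    unfolding R .
  also have "4 * a * c\<^sup>2 + 2 * b * c * (b + s) = c * (4 * a * c + 2 * b\<^sup>2 + 2 * b * s)"
    by (simp add: algebra_simps power2_eq_square)
  also have "4 * a * c + 2 * b\<^sup>2 + 2 * b * s = (b + s)\<^sup>2"
    using s2 by (simp add: algebra_simps power2_eq_square)
  finally show "a * R\<^sup>2 + b * R = c"
    using pos by simp
qed

lemma quadratic_increasing:
  fixes a b x R :: real
  assumes "a > 0" "b > 0" "0 \<le> x" "x < R"
  shows "a * x\<^sup>2 + b * x < a * R\<^sup>2 + b * R"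
proof -
  have "x\<^sup>2 < R\<^sup>2" using assms by (intro power_strict_mono) auto
  then show ?thesis using assms by (intro add_strict_mono mult_strict_left_mono)
qed

lemma one_minus_square_pos: "z \<in> \<D> \<Longrightarrow> 1 - (cmod z)\<^sup>2 > 0"
  by (simp add: power_less_one_iff)

lemma radius_lune_G1:
  assumes R: "0 < R" "R < 1" and eq: "(2 - sqrt 2) * R\<^sup>2 + 6 * R = 2 - sqrt 2"
  shows "is_radius class_S_lune class_G1 R"
  unfolding is_radius_def
proof (intro conjI allI impI)
  have c: "2 - sqrt 2 > 0"
    using sqrt2_less_2 by linarith
  show "radius_admissible class_S_lune class_G1 R"
  proof (rule radius_admissible_lune[OF R])
    show "class_G1 \<subseteq> class_A" by (auto simp: class_G1_def)
    fix f assume "f \<in> class_G1"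
    then obtain g p where f: "f \<in> class_A" and g: "g \<in> class_A" and p: "p \<in> class_P"
      and h: "remove_sings (\<lambda>z. f z / g z) \<in> class_P"
      and k: "remove_sings (\<lambda>z. g z / (z * p z)) \<in> class_P"
      by (auto simp: class_G1_def)
    define h' where "h' = remove_sings (\<lambda>z. f z / g z)"
    define k' where "k' = remove_sings (\<lambda>z. g z / (z * p z))"
    have h': "h' \<in> class_P" and k': "k' \<in> class_P"
      using h k by (simp_all add: h'_def k'_def)
    note hol = class_P_holomorphic[OF p] class_P_holomorphic[OF h'] class_P_holomorphic[OF k']
    note nz = class_P_nonzero[OF p] class_P_nonzero[OF h'] class_P_nonzero[OF k']
    have holph: "(\<lambda>z. p z * h' z) holomorphic_on \<D>" by (intro holomorphic_intros hol)
    define P where "P = (\<lambda>z. p z * h' z * k' z)"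
    have "P holomorphic_on \<D>" unfolding P_def by (intro holomorphic_intros hol)
    moreover have "P z \<noteq> 0 \<and> f z = z * P z \<and>
        (cmod z < R \<longrightarrow> cmod (z * deriv P z / P z) < 2 - sqrt 2)" if z: "z \<in> \<D>" for z
    proof (intro conjI impI)
      show "P z \<noteq> 0" using nz z by (simp add: P_def)
      show "f z = z * P z"
        unfolding P_def h'_def k'_def by (rule factor_over_intermediate[OF f g p k z])
      assume zR: "cmod z < R"
      have "z * deriv P z / P z = z * deriv p z / p z + z * deriv h' z / h' z + z * deriv k' z / k' z"
        unfolding P_def
        using logderiv_mult[OF holph hol(3) z] logderiv_mult[OF hol(1,2) z] nz z by simp
      also have "cmod \<dots> \<le> cmod (z * deriv p z / p z) + cmod (z * deriv h' z / h' z)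
                              + cmod (z * deriv k' z / k' z)"
        by (intro norm_triangle_le order_refl add_mono norm_triangle_ineq)
      also have "\<dots> \<le> 2 * cmod z / (1 - (cmod z)\<^sup>2) + 2 * cmod z / (1 - (cmod z)\<^sup>2)
                        + 2 * cmod z / (1 - (cmod z)\<^sup>2)"
        by (intro add_mono class_P_logderiv_bound p h' k' z)
      also have "\<dots> = 6 * cmod z / (1 - (cmod z)\<^sup>2)"
        by (simp add: add_divide_distrib[symmetric])
      also have "\<dots> < 2 - sqrt 2"
        unfolding pos_divide_less_eq[OF one_minus_square_pos[OF z]]
        using quadratic_increasing[OF c, of 6 "cmod z" R] zR eq by (simp add: algebra_simps)
      finally show "cmod (z * deriv P z / P z) < 2 - sqrt 2" .
    qed
    ultimately show "\<exists>P. P holomorphic_on \<D> \<and> (\<forall>z\<in>\<D>. P z \<noteq> 0 \<and> f z = z * P z \<and>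
        (cmod z < R \<longrightarrow> cmod (z * deriv P z / P z) < 2 - sqrt 2))"
      by blast
  qed
  fix R' assume "radius_admissible class_S_lune class_G1 R'"
  then show "R' \<le> R"
  proof (rule radius_le_of_extremal[OF extremal_in_G1 R, rotated])
    have "1 - R\<^sup>2 > 0" using R by (simp add: power_less_one_iff)
    then have ne: "1 - R\<^sup>2 \<noteq> 0" by simp
    show "2 * real 3 * R / (1 - R\<^sup>2) = 2 - sqrt 2"
      unfolding nonzero_divide_eq_eq[OF ne] using eq by (simp add: algebra_simps)
  qed
qed

lemma radius_lune_G3:
  assumes R: "0 < R" "R < 1" and eq: "(2 - sqrt 2) * R\<^sup>2 + 4 * R = 2 - sqrt 2"
  shows "is_radius class_S_lune class_G3 R"
    and "radius_admissible class_S_lune class_G2 R' \<Longrightarrow> R' \<le> R"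
proof -
  have "1 - R\<^sup>2 > 0" using R by (simp add: power_less_one_iff)
  then have ne: "1 - R\<^sup>2 \<noteq> 0" by simp
  have Req: "2 * real 2 * R / (1 - R\<^sup>2) = 2 - sqrt 2"
    unfolding nonzero_divide_eq_eq[OF ne] using eq by (simp add: algebra_simps)
  have c: "2 - sqrt 2 > 0"
    using sqrt2_less_2 by linarith
  show "radius_admissible class_S_lune class_G2 R' \<Longrightarrow> R' \<le> R"
    by (rule radius_le_of_extremal[OF extremal_in_G2 R Req])
  have "radius_admissible class_S_lune class_G3 R"
  proof (rule radius_admissible_lune[OF R])
    show "class_G3 \<subseteq> class_A" by (auto simp: class_G3_def)
    fix f assume "f \<in> class_G3"
    then obtain p where f: "f \<in> class_A" and p: "p \<in> class_P"
      and h: "remove_sings (\<lambda>z. f z / (z * p z)) \<in> class_P"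
      by (auto simp: class_G3_def)
    define h' where "h' = remove_sings (\<lambda>z. f z / (z * p z))"
    have h': "h' \<in> class_P"
      using h by (simp add: h'_def)
    note hol = class_P_holomorphic[OF p] class_P_holomorphic[OF h']
    note nz = class_P_nonzero[OF p] class_P_nonzero[OF h']
    define P where "P = (\<lambda>z. p z * h' z)"
    have "P holomorphic_on \<D>" unfolding P_def by (intro holomorphic_intros hol)
    moreover have "P z \<noteq> 0 \<and> f z = z * P z \<and>
        (cmod z < R \<longrightarrow> cmod (z * deriv P z / P z) < 2 - sqrt 2)" if z: "z \<in> \<D>" for z
    proof (intro conjI impI)
      show "P z \<noteq> 0" using nz z by (simp add: P_def)
      show "f z = z * P z"
        unfolding P_def h'_def by (rule factor_over_class_P[OF f p z])
      assume zR: "cmod z < R"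
      have "z * deriv P z / P z = z * deriv p z / p z + z * deriv h' z / h' z"
        unfolding P_def using logderiv_mult[OF hol z] nz z by simp
      also have "cmod \<dots> \<le> cmod (z * deriv p z / p z) + cmod (z * deriv h' z / h' z)"
        by (rule norm_triangle_ineq)
      also have "\<dots> \<le> 2 * cmod z / (1 - (cmod z)\<^sup>2) + 2 * cmod z / (1 - (cmod z)\<^sup>2)"
        by (intro add_mono class_P_logderiv_bound p h' z)
      also have "\<dots> = 4 * cmod z / (1 - (cmod z)\<^sup>2)"
        by (simp add: add_divide_distrib[symmetric])
      also have "\<dots> < 2 - sqrt 2"
        unfolding pos_divide_less_eq[OF one_minus_square_pos[OF z]]
        using quadratic_increasing[OF c, of 4 "cmod z" R] zR eq by (simp add: algebra_simps)
      finally show "cmod (z * deriv P z / P z) < 2 - sqrt 2" .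
    qed
    ultimately show "\<exists>P. P holomorphic_on \<D> \<and> (\<forall>z\<in>\<D>. P z \<noteq> 0 \<and> f z = z * P z \<and>
        (cmod z < R \<longrightarrow> cmod (z * deriv P z / P z) < 2 - sqrt 2))"
      by blast
  qed
  then show "is_radius class_S_lune class_G3 R"
    unfolding is_radius_def using radius_le_of_extremal[OF extremal_in_G3 R Req] by blast
qed

lemma radius_admissible_lune_G2:
  assumes R: "0 < R" "R < 1" and eq: "(3 - sqrt 2) * R\<^sup>2 + 5 * R = 2 - sqrt 2"
  shows "radius_admissible class_S_lune class_G2 R"
proof (rule radius_admissible_lune[OF R])
  have c: "3 - sqrt 2 > 0"
    using sqrt2_less_2 by linarith
  show "class_G2 \<subseteq> class_A" by (auto simp: class_G2_def)
  fix f assume "f \<in> class_G2"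
  then obtain g p where f: "f \<in> class_A" and g: "g \<in> class_A" and p: "p \<in> class_P"
    and h: "remove_sings (\<lambda>z. f z / g z) \<in> class_P"
    and k: "remove_sings (\<lambda>z. g z / (z * p z)) \<in> class_P_half"
    by (auto simp: class_G2_def)
  define h' where "h' = remove_sings (\<lambda>z. f z / g z)"
  define k' where "k' = remove_sings (\<lambda>z. g z / (z * p z))"
  have kP: "remove_sings (\<lambda>z. g z / (z * p z)) \<in> class_P"
    using k by (simp add: class_P_half_def)
  have h': "h' \<in> class_P" and k': "k' \<in> class_P" and k2: "k' \<in> class_P_half"
    using h k kP by (simp_all add: h'_def k'_def)
  note hol = class_P_holomorphic[OF p] class_P_holomorphic[OF h'] class_P_holomorphic[OF k']
  note nz = class_P_nonzero[OF p] class_P_nonzero[OF h'] class_P_nonzero[OF k']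
  have holph: "(\<lambda>z. p z * h' z) holomorphic_on \<D>" by (intro holomorphic_intros hol)
  define P where "P = (\<lambda>z. p z * h' z * k' z)"
  have "P holomorphic_on \<D>" unfolding P_def by (intro holomorphic_intros hol)
  moreover have "P z \<noteq> 0 \<and> f z = z * P z \<and>
      (cmod z < R \<longrightarrow> cmod (z * deriv P z / P z) < 2 - sqrt 2)" if z: "z \<in> \<D>" for z
  proof (intro conjI impI)
    show "P z \<noteq> 0" using nz z by (simp add: P_def)
    show "f z = z * P z"
      unfolding P_def h'_def k'_def by (rule factor_over_intermediate[OF f g p kP z])
    assume zR: "cmod z < R"
    have z1: "cmod z < 1" "1 + cmod z > 0"
      using z norm_ge_zero[of z] by (simp, linarith)
    have "z * deriv P z / P z = z * deriv p z / p z + z * deriv h' z / h' z + z * deriv k' z / k' z"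
      unfolding P_def
      using logderiv_mult[OF holph hol(3) z] logderiv_mult[OF hol(1,2) z] nz z by simp
    also have "cmod \<dots> \<le> cmod (z * deriv p z / p z) + cmod (z * deriv h' z / h' z)
                            + cmod (z * deriv k' z / k' z)"
      by (intro norm_triangle_le order_refl add_mono norm_triangle_ineq)
    also have "\<dots> \<le> 2 * cmod z / (1 - (cmod z)\<^sup>2) + 2 * cmod z / (1 - (cmod z)\<^sup>2)
                      + cmod z / (1 - cmod z)"
      by (intro add_mono class_P_logderiv_bound class_P_half_logderiv_bound p h' k2 z)
    also have "cmod z / (1 - cmod z) = (cmod z + (cmod z)\<^sup>2) / (1 - (cmod z)\<^sup>2)"
    proof -
      have "(cmod z + (cmod z)\<^sup>2) / (1 - (cmod z)\<^sup>2)
              = (cmod z * (1 + cmod z)) / ((1 - cmod z) * (1 + cmod z))"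
        by (simp add: power2_eq_square algebra_simps)
      then show ?thesis using z1 by simp
    qed
    also have "2 * cmod z / (1 - (cmod z)\<^sup>2) + 2 * cmod z / (1 - (cmod z)\<^sup>2)
          + (cmod z + (cmod z)\<^sup>2) / (1 - (cmod z)\<^sup>2) = (5 * cmod z + (cmod z)\<^sup>2) / (1 - (cmod z)\<^sup>2)"
      by (simp add: add_divide_distrib[symmetric])
    also have "\<dots> < 2 - sqrt 2"
      unfolding pos_divide_less_eq[OF one_minus_square_pos[OF z]]
      using quadratic_increasing[OF c, of 5 "cmod z" R] zR eq by (simp add: algebra_simps)
    finally show "cmod (z * deriv P z / P z) < 2 - sqrt 2" .
  qed
  ultimately show "\<exists>P. P holomorphic_on \<D> \<and> (\<forall>z\<in>\<D>. P z \<noteq> 0 \<and> f z = z * P z \<and>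
      (cmod z < R \<longrightarrow> cmod (z * deriv P z / P z) < 2 - sqrt 2))"
    by blast
qed

text \<open>
  Admissibility at \<open>R\<close> only constrains the scaling factors strictly below \<open>R\<close>, so it passes to
  the supremum of the admissible numbers.
\<close>

lemma is_radius_exists:
  assumes adm: "radius_admissible G F R0" and bd: "\<And>R. radius_admissible G F R \<Longrightarrow> R \<le> B"
    and B: "B < 1"
  shows "\<exists>R. is_radius G F R \<and> R0 \<le> R"
proof -
  define A where "A = {R. radius_admissible G F R}"
  have bdd: "bdd_above A"
    unfolding A_def using bd by (intro bdd_aboveI[of _ B]) auto
  have R0: "R0 \<in> A" using adm by (simp add: A_def)
  have upper: "R \<le> Sup A" if "radius_admissible G F R" for R
    using bdd that by (intro cSup_upper) (auto simp: A_def)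
  have "Sup A \<le> B"
    using R0 bd by (intro cSup_least) (auto simp: A_def)
  moreover have "Sup A > 0"
    using upper[OF adm] adm by (simp add: radius_admissible_def)
  moreover have "(\<lambda>z. f (of_real r * z) / of_real r) \<in> G" if f: "f \<in> F" and r: "0 < r" "r < Sup A" for f r
  proof -
    obtain R where "R \<in> A" "r < R"
      using r R0 bdd less_cSup_iff by blast
    then show ?thesis using f r by (auto simp: A_def radius_admissible_def)
  qed
  ultimately have "radius_admissible G F (Sup A)"
    using B by (simp add: radius_admissible_def)
  then show ?thesis
    using upper adm by (auto simp: is_radius_def)
qed

text \<open>
  Locating a root by the sign of the quadratic at two points avoids estimating the nested radicals.
\<close>

lemma quadratic_root_close:
  fixes a b c R m e :: real
  assumes ab: "a > 0" "b > 0" and R: "R > 0" "a * R\<^sup>2 + b * R = c" and e: "0 < m - e" "0 < e"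
    and lo: "a * (m - e)\<^sup>2 + b * (m - e) < c" and hi: "c < a * (m + e)\<^sup>2 + b * (m + e)"
  shows "\<bar>R - m\<bar> < e"
proof -
  have "R > m - e"
  proof (rule ccontr)
    assume "\<not> R > m - e"
    then have "R = m - e \<or> R < m - e" by linarith
    then show False
      using quadratic_increasing[OF ab, of R "m - e"] R lo by auto
  qed
  moreover have "R < m + e"
  proof (rule ccontr)
    assume "\<not> R < m + e"
    then have "R = m + e \<or> m + e < R" by linarith
    then show False
      using quadratic_increasing[OF ab, of "m + e" R] R hi e by auto
  qed
  ultimately show ?thesis by (simp add: abs_less_iff)
qed

lemma sqrt2_bounds: "1414213 / 1000000 < sqrt 2" "sqrt 2 < 1414214 / 1000000"
  by (rule real_less_rsqrt, simp add: power2_eq_square)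
     (rule real_less_lsqrt, simp_all add: power2_eq_square)

theorem theorem3p7:
  "let R1 = (6 - 4 * sqrt 2) / ((2 - sqrt 2) * (3 + sqrt (15 - 4 * sqrt 2)));
       R2 = (16 - 10 * sqrt 2) / ((3 - sqrt 2) * (5 + sqrt (57 - 20 * sqrt 2)));
       R3 = (6 - 4 * sqrt 2) / ((2 - sqrt 2) * (2 + sqrt (10 - 4 * sqrt 2)))
   in (is_radius class_S_lune class_G1 R1 \<and> \<bar>R1 - 0.0967\<bar> < 0.00005) \<and>
      ((\<exists>R. is_radius class_S_lune class_G2 R \<and> R \<ge> R2) \<and> \<bar>R2 - 0.1131\<bar> < 0.00005) \<and>
      (is_radius class_S_lune class_G3 R3 \<and> \<bar>R3 - 0.1434\<bar> < 0.00005)"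
proof -
  define s where "s = sqrt (2::real)"
  define R1 where "R1 = (6 - 4 * s) / ((2 - s) * (3 + sqrt (15 - 4 * s)))"
  define R2 where "R2 = (16 - 10 * s) / ((3 - s) * (5 + sqrt (57 - 20 * s)))"
  define R3 where "R3 = (6 - 4 * s) / ((2 - s) * (2 + sqrt (10 - 4 * s)))"
  have s2: "s * s = 2" by (simp add: s_def)
  have sb: "1414213 / 1000000 < s" "s < 1414214 / 1000000"
    using sqrt2_bounds by (simp_all add: s_def)
  have pos: "2 - s > 0" "3 - s > 0" using sb by linarith+
  (* 6 - 4 s = (2 - s)^2 and 16 - 10 s = 2 (2 - s) (3 - s), so the stated fractions
     are the rationalised roots of the three quadratics. *)
  have halve: "2 * x / (2 * a + 2 * t) = x / (a + t)" for x a t :: real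
    unfolding distrib_left[symmetric] by (rule mult_divide_mult_cancel_left) simp
  have "R1 = (2 - s) / (3 + sqrt (15 - 4 * s))"
    using pos s2 by (simp add: R1_def divide_simps) (simp add: algebra_simps)
  moreover have "6\<^sup>2 + 4 * (2 - s) * (2 - s) = 2\<^sup>2 * (15 - 4 * s)"
    using s2 by (simp add: algebra_simps)
  then have "sqrt (6\<^sup>2 + 4 * (2 - s) * (2 - s)) = 2 * sqrt (15 - 4 * s)"
    by (simp only: real_sqrt_mult real_sqrt_abs)
  ultimately have "R1 = 2 * (2 - s) / (6 + sqrt (6\<^sup>2 + 4 * (2 - s) * (2 - s)))"
    using halve[of "2 - s" 3 "sqrt (15 - 4 * s)"] by simp
  then have R1: "R1 > 0" "(2 - s) * R1\<^sup>2 + 6 * R1 = 2 - s"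
    using positive_root_quadratic[of "2 - s" 6 "2 - s"] pos by simp_all
  have "R3 = (2 - s) / (2 + sqrt (10 - 4 * s))"
    using pos s2 by (simp add: R3_def divide_simps) (simp add: algebra_simps)
  moreover have "4\<^sup>2 + 4 * (2 - s) * (2 - s) = 2\<^sup>2 * (10 - 4 * s)"
    using s2 by (simp add: algebra_simps)
  then have "sqrt (4\<^sup>2 + 4 * (2 - s) * (2 - s)) = 2 * sqrt (10 - 4 * s)"
    by (simp only: real_sqrt_mult real_sqrt_abs)
  ultimately have "R3 = 2 * (2 - s) / (4 + sqrt (4\<^sup>2 + 4 * (2 - s) * (2 - s)))"
    using halve[of "2 - s" 2 "sqrt (10 - 4 * s)"] by simp
  then have R3: "R3 > 0" "(2 - s) * R3\<^sup>2 + 4 * R3 = 2 - s"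
    using positive_root_quadratic[of "2 - s" 4 "2 - s"] pos by simp_all
  have "R2 = 2 * (2 - s) / (5 + sqrt (57 - 20 * s))"
    using pos s2 by (simp add: R2_def divide_simps) (simp add: algebra_simps)
  moreover have "57 - 20 * s = 5\<^sup>2 + 4 * (3 - s) * (2 - s)"
    using s2 by (simp add: algebra_simps)
  ultimately have "R2 = 2 * (2 - s) / (5 + sqrt (5\<^sup>2 + 4 * (3 - s) * (2 - s)))"
    by simp
  then have R2: "R2 > 0" "(3 - s) * R2\<^sup>2 + 5 * R2 = 2 - s"
    using positive_root_quadratic[of "3 - s" 5 "2 - s"] pos by simp_all
  have near1: "\<bar>R1 - 0.0967\<bar> < 0.00005"
    by (rule quadratic_root_close[OF pos(1) _ R1])
       (use sb in \<open>simp_all add: power2_eq_square field_simps\<close>)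
  have near2: "\<bar>R2 - 0.1131\<bar> < 0.00005"
    by (rule quadratic_root_close[OF pos(2) _ R2])
       (use sb in \<open>simp_all add: power2_eq_square field_simps\<close>)
  have near3: "\<bar>R3 - 0.1434\<bar> < 0.00005"
    by (rule quadratic_root_close[OF pos(1) _ R3])
       (use sb in \<open>simp_all add: power2_eq_square field_simps\<close>)
  have "x < 1" if "\<bar>x - m\<bar> < e" "m + e \<le> 1" for x m e :: real
    using that by linarith
  from this[OF near1] this[OF near2] this[OF near3]
  have lt1: "R1 < 1" "R2 < 1" "R3 < 1"
    by simp_all
  have G1: "is_radius class_S_lune class_G1 R1"
    using R1 lt1 by (intro radius_lune_G1) (simp_all add: s_def)
  have eq3: "(2 - sqrt 2) * R3\<^sup>2 + 4 * R3 = 2 - sqrt 2"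
    using R3(2) by (simp add: s_def)
  have "radius_admissible class_S_lune class_G2 R2"
    using R2 lt1 by (intro radius_admissible_lune_G2) (simp_all add: s_def)
  then have G2: "\<exists>R. is_radius class_S_lune class_G2 R \<and> R2 \<le> R"
    by (rule is_radius_exists[OF _ radius_lune_G3(2)[OF R3(1) lt1(3) eq3] lt1(3)])
  show ?thesis
    unfolding Let_def s_def[symmetric] R1_def[symmetric] R2_def[symmetric] R3_def[symmetric]
    using G1 G2 radius_lune_G3(1)[OF R3(1) lt1(3) eq3] near1 near2 near3 by blast
qed

end
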